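(* Let $(\varphi_{\mathrm{AE}},\varrho_{\mathrm{AE}})\in\mathcal F_{\varphi,\varrho,\mathrm{AE}}$ be an autoencoder pair which is Lipschitz continuous with constants $C_\varphi\ge0$ and $C_\varrho\ge0$, i.e. $$\|\varphi_{\mathrm{AE}}(\check m)-\varphi_{\mathrm{AE}}(\check w)\|_{g}\le C_\varphi\|\check m-\check w\|_{\check g}\quad\forall\check m,\check w\in\mathbb R^n,\qquad \|\varrho_{\mathrm{AE}}(m)-\varrho_{\mathrm{AE}}(w)\|_{\check g}\le C_\varrho\|m-w\|_{g}\quad\forall m,w\in\mathbb R^N,$$ and let $L_{\mathrm{MSE}}(\varphi_{\mathrm{AE}},\varrho_{\mathrm{AE}})\ge 0$ be its mean squared error value. Then the point projection property $\varrho_{\mathrm{AE}}\circ\varphi_{\mathrm{AE}}=\mathrm{id}_{\mathbb R^n}$ is fulfilled approximately in the sense that for each $\check m\in\mathbb R^n$ $$\|(\varrho_{\mathrm{AE}}\circ\varphi_{\mathrm{AE}})(\check m)-\check m\|_{\check g}\le C_\varrho\sqrt{|S_{\mathrm{train}}|\,L_{\mathrm{MSE}}(\varphi_{\mathrm{AE}},\varrho_{\mathrm{AE}})}+(C_\varrho C_\varphi+1)\min_{w\in S_{\mathrm{train}}}\|\check m-\varrho_{\mathrm{AE}}(w)\|_{\check g}.$$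
   Context: $S_{\mathrm{train}}\subset\mathbb R^N$ is a finite nonempty set of snapshots with cardinality $|S_{\mathrm{train}}|$. $\|m\|_g=\sqrt{m^\top g\,m}$ for a symmetric positive-definite matrix $g\in\mathbb R^{N\times N}$, and $\|\cdot\|_{\check g}$ is a given norm on $\mathbb R^n$. The family $\mathcal F_{\varphi,\varrho,\mathrm{AE}}$ consists of pairs of smooth maps $\varphi_{\mathrm{AE}}\in C^\infty(\mathbb R^n,\mathbb R^N)$ (decoder) and $\varrho_{\mathrm{AE}}\in C^\infty(\mathbb R^N,\mathbb R^n)$ (encoder), both given by artificial neural networks (of arbitrary architecture) with network parameters $\theta\in\mathbb R^{n_\theta}$. The mean squared error is $$L_{\mathrm{MSE}}(\varphi,\varrho)=\frac1{|S_{\mathrm{train}}|}\sum_{m\in S_{\mathrm{train}}}\|m-(\varphi\circ\varrho)(m)\|_g^2 .$$ *)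

theory Defs
  imports "HOL-Analysis.Analysis"
begin

section \<open>Smooth maps\<close>

text \<open>As the \<open>k\<close>-th derivative is multilinear in its directions, it suffices to
  differentiate the directional derivatives along every fixed direction \<open>v\<close>.\<close>

primrec times_differentiable ::
  "nat \<Rightarrow> ('a::real_normed_vector \<Rightarrow> 'b::real_normed_vector) \<Rightarrow> bool" where
  "times_differentiable 0 f \<longleftrightarrow> continuous_on UNIV f"
| "times_differentiable (Suc k) f \<longleftrightarrow>
     (\<forall>x. f differentiable at x) \<and>
     (\<forall>v. times_differentiable k (\<lambda>x. frechet_derivative f (at x) v))"

definition smooth :: "('a::euclidean_space \<Rightarrow> 'b::euclidean_space) \<Rightarrow> bool" where
  "smooth f \<longleftrightarrow> (\<forall>k. times_differentiable k f)"


section \<open>Norms\<close>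

definition sym_pos_def :: "real^'N^'N \<Rightarrow> bool" where
  "sym_pos_def g \<longleftrightarrow> transpose g = g \<and> (\<forall>x. x \<noteq> 0 \<longrightarrow> 0 < x \<bullet> (g *v x))"

definition mat_norm :: "real^'N^'N \<Rightarrow> real^'N \<Rightarrow> real" where
  "mat_norm g m = sqrt (m \<bullet> (g *v m))"

definition is_norm :: "('a::real_vector \<Rightarrow> real) \<Rightarrow> bool" where
  "is_norm p \<longleftrightarrow>
     (\<forall>x. 0 \<le> p x) \<and> (\<forall>x. p x = 0 \<longleftrightarrow> x = 0) \<and>
     (\<forall>c x. p (c *\<^sub>R x) = \<bar>c\<bar> * p x) \<and>
     (\<forall>x y. p (x + y) \<le> p x + p y)"


section \<open>Artificial neural networks\<close>

text \<open>A network with inputs \<open>x $ i\<close>, \<open>i :: 'i\<close>, and parameter vector \<open>\<theta> :: real^'t\<close> is a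
  finite directed acyclic graph of neurons, given in topological order. Each neuron applies
  its own scalar activation function to an affine combination of the inputs (indexed by
  \<open>Inl\<close>) and of the outputs of all earlier neurons (indexed by \<open>Inr\<close>). Missing edges have
  weight zero. Since every weight and bias is an arbitrary function of \<open>\<theta>\<close>, weights may be
  trainable, shared (as in convolutions) or frozen, and connections may skip layers.\<close>

record ('i, 't::finite) neuron =
  weight :: "real^'t \<Rightarrow> 'i + nat \<Rightarrow> real"
  bias :: "real^'t \<Rightarrow> real"
  activation :: "real \<Rightarrow> real"

definition neuron_output ::
  "('i::finite, 't::finite) neuron \<Rightarrow> real^'t \<Rightarrow> real^'i \<Rightarrow> real list \<Rightarrow> real" where
  "neuron_output \<nu> \<theta> x hs =
     activation \<nu> ((\<Sum>i\<in>UNIV. weight \<nu> \<theta> (Inl i) * x $ i) +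
                   (\<Sum>j<length hs. weight \<nu> \<theta> (Inr j) * hs ! j) + bias \<nu> \<theta>)"

definition neuron_outputs ::
  "('i::finite, 't::finite) neuron list \<Rightarrow> real^'t \<Rightarrow> real^'i \<Rightarrow> real list" where
  "neuron_outputs \<nu>s \<theta> x = foldl (\<lambda>hs \<nu>. hs @ [neuron_output \<nu> \<theta> x hs]) [] \<nu>s"

record ('i, 'o, 't::finite) network =
  neurons :: "('i, 't) neuron list"
  output_neuron :: "'o \<Rightarrow> nat"

definition wf_network :: "('i, 'o, 't::finite) network \<Rightarrow> bool" where
  "wf_network A \<longleftrightarrow> (\<forall>k. output_neuron A k < length (neurons A))"

definition realization ::
  "('i::finite, 'o::finite, 't::finite) network \<Rightarrow> real^'t \<Rightarrow> real^'i \<Rightarrow> real^'o" where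
  "realization A \<theta> x = (\<chi> k. neuron_outputs (neurons A) \<theta> x ! output_neuron A k)"


section \<open>Autoencoders\<close>

definition autoencoder_family ::
  "('n::finite, 'N::finite, 't::finite) network \<Rightarrow> ('N::finite, 'n::finite, 't::finite) network \<Rightarrow>
   ((real^'n \<Rightarrow> real^'N) \<times> (real^'N \<Rightarrow> real^'n)) set" where
  "autoencoder_family D E =
     {(\<phi>, \<rho>). smooth \<phi> \<and> smooth \<rho> \<and>
              (\<exists>\<theta>. \<phi> = realization D \<theta> \<and> \<rho> = realization E \<theta>)}"

definition L_MSE ::
  "real^'N^'N \<Rightarrow> (real^'N) set \<Rightarrow> (real^'n \<Rightarrow> real^'N) \<Rightarrow> (real^'N \<Rightarrow> real^'n) \<Rightarrow> real" where
  "L_MSE g S \<phi> \<rho> =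
     1 / real (card S) * (\<Sum>m\<in>S. (mat_norm g (m - (\<phi> \<circ> \<rho>) m))\<^sup>2)"

end

theory Submission
  imports Defs
begin

text \<open>The encoder inverts the decoder approximately at the encoded snapshots: for a snapshot
  \<open>w\<close>, the points \<open>\<rho> (\<phi> (\<rho> w))\<close> and \<open>\<rho> w\<close> are the codes of the reconstruction \<open>\<phi> (\<rho> w)\<close> and of
  \<open>w\<close> itself, so their distance is at most \<open>C\<rho>\<close> times the reconstruction error at \<open>w\<close>, which the mean
  squared error controls (lemma \<open>reconstruction_error_le\<close>). Any other point \<open>x\<close> is compared with
  the encoded snapshot \<open>\<rho> w\<close> closest to it: passing from \<open>x\<close> to \<open>\<rho> w\<close> moves the value of
  \<open>\<rho> \<circ> \<phi>\<close> by at most \<open>C\<rho> * C\<phi>\<close> times their distance, and the value of the identity by exactly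
  their distance. The triangle inequality adds up the three contributions.\<close>

lemma is_norm_minus_commute:
  assumes "is_norm p"
  shows "p (x - y) = p (y - x)"
proof -
  have "p ((-1) *\<^sub>R (y - x)) = \<bar>-1\<bar> * p (y - x)"
    using assms unfolding is_norm_def by blast
  then show ?thesis by simp
qed

lemma is_norm_triangle3:
  assumes "is_norm p"
  shows "p (a - d) \<le> p (a - b) + p (b - c) + p (c - d)"
proof -
  have sub: "p (u + v) \<le> p u + p v" for u v
    using assms unfolding is_norm_def by blast
  have "p (a - d) \<le> p (a - b) + p (b - d)"
    using sub[of "a - b" "b - d"] by simp
  moreover have "p (b - d) \<le> p (b - c) + p (c - d)"
    using sub[of "b - c" "c - d"] by simp
  ultimately show ?thesis by linarith
qed

text \<open>Multiplying the mean by the number of snapshots recovers the sum of the squared errors, which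
  dominates each of its nonnegative terms.\<close>

lemma reconstruction_error_le:
  assumes "finite S" and "w \<in> S"
  shows "mat_norm g (w - \<phi> (\<rho> w)) \<le> sqrt (real (card S) * L_MSE g S \<phi> \<rho>)"
proof -
  have "card S \<noteq> 0"
    using assms by auto
  then have "real (card S) * L_MSE g S \<phi> \<rho> = (\<Sum>m\<in>S. (mat_norm g (m - \<phi> (\<rho> m)))\<^sup>2)"
    by (simp add: L_MSE_def)
  moreover have "(mat_norm g (w - \<phi> (\<rho> w)))\<^sup>2 \<le> (\<Sum>m\<in>S. (mat_norm g (m - \<phi> (\<rho> m)))\<^sup>2)"
    using assms by (intro member_le_sum) auto
  ultimately show ?thesis
    by (simp add: real_le_rsqrt)
qed

theorem theorem6p4:
  fixes S_train :: "(real^'N) set"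
    and g :: "real^'N^'N"
    and norm_red :: "real^'n \<Rightarrow> real"
    and D :: "('n, 'N, 't::finite) network"
    and E :: "('N, 'n, 't) network"
    and \<phi> :: "real^'n \<Rightarrow> real^'N"
    and \<rho> :: "real^'N \<Rightarrow> real^'n"
    and C\<phi> C\<rho> :: real
  assumes "finite S_train" and "S_train \<noteq> {}"
    and "sym_pos_def g"
    and "is_norm norm_red"
    and "wf_network D" and "wf_network E"
    and "(\<phi>, \<rho>) \<in> autoencoder_family D E"
    and "0 \<le> C\<phi>" and "0 \<le> C\<rho>"
    and "\<forall>x y. mat_norm g (\<phi> x - \<phi> y) \<le> C\<phi> * norm_red (x - y)"
    and "\<forall>m w. norm_red (\<rho> m - \<rho> w) \<le> C\<rho> * mat_norm g (m - w)"
  shows "\<forall>x. norm_red ((\<rho> \<circ> \<phi>) x - x)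
    \<le> C\<rho> * sqrt (real (card S_train) * L_MSE g S_train \<phi> \<rho>)
      + (C\<rho> * C\<phi> + 1) * Min ((\<lambda>w. norm_red (x - \<rho> w)) ` S_train)"
proof
  fix x
  have "Min ((\<lambda>w. norm_red (x - \<rho> w)) ` S_train) \<in> (\<lambda>w. norm_red (x - \<rho> w)) ` S_train"
    using assms(1,2) by (intro Min_in) auto
  then obtain w where w: "w \<in> S_train"
    and nearest: "Min ((\<lambda>w. norm_red (x - \<rho> w)) ` S_train) = norm_red (x - \<rho> w)"
    by blast
  have "norm_red (\<rho> (\<phi> x) - \<rho> (\<phi> (\<rho> w))) \<le> C\<rho> * mat_norm g (\<phi> x - \<phi> (\<rho> w))"
    using assms(11) by blast
  also have "\<dots> \<le> C\<rho> * (C\<phi> * norm_red (x - \<rho> w))"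
    using assms(9,10) by (intro mult_left_mono) auto
  finally have moved: "norm_red (\<rho> (\<phi> x) - \<rho> (\<phi> (\<rho> w))) \<le> C\<rho> * C\<phi> * norm_red (x - \<rho> w)"
    by (simp add: mult.assoc)
  have "norm_red (\<rho> (\<phi> (\<rho> w)) - \<rho> w) = norm_red (\<rho> w - \<rho> (\<phi> (\<rho> w)))"
    by (rule is_norm_minus_commute[OF assms(4)])
  also have "\<dots> \<le> C\<rho> * mat_norm g (w - \<phi> (\<rho> w))"
    using assms(11) by blast
  also have "\<dots> \<le> C\<rho> * sqrt (real (card S_train) * L_MSE g S_train \<phi> \<rho>)"
    using reconstruction_error_le[OF assms(1) w] assms(9) by (rule mult_left_mono)
  finally have trained: "norm_red (\<rho> (\<phi> (\<rho> w)) - \<rho> w)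
    \<le> C\<rho> * sqrt (real (card S_train) * L_MSE g S_train \<phi> \<rho>)" .
  have "norm_red (\<rho> (\<phi> x) - x)
    \<le> norm_red (\<rho> (\<phi> x) - \<rho> (\<phi> (\<rho> w))) + norm_red (\<rho> (\<phi> (\<rho> w)) - \<rho> w) + norm_red (\<rho> w - x)"
    by (rule is_norm_triangle3[OF assms(4)])
  then show "norm_red ((\<rho> \<circ> \<phi>) x - x)
    \<le> C\<rho> * sqrt (real (card S_train) * L_MSE g S_train \<phi> \<rho>)
      + (C\<rho> * C\<phi> + 1) * Min ((\<lambda>w. norm_red (x - \<rho> w)) ` S_train)"
    using moved trained is_norm_minus_commute[OF assms(4), of "\<rho> w" x]
    unfolding nearest by (simp add: distrib_right)
qed

end
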